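(* For any finite simple undirected graph $G$ of order $n$ and any minimal local set $A$ of $G$, \[|A|\le \begin{cases} n/2 & \text{if } n\equiv 0 \pmod 4,\\ \lfloor n/2\rfloor+1 & \text{otherwise.}\end{cases}\] Moreover this bound is tight: for every $n>0$ there exists a graph of order $n$ that contains a minimal local set whose size equals the right-hand side.
   Context: For a finite simple undirected graph $G=(V,E)$ and $D\subseteq V$, the odd neighborhood of $D$ is $Odd_G(D)=\{v\in V : |N_G(v)\cap D| \equiv 1 \pmod 2\}$, where $N_G(v)$ is the set of neighbors of $v$. A local set of $G$ is a non-empty subset $L\subseteq V$ of the form $L=D\cup Odd_G(D)$ for some $D\subseteq V$. A minimal local set is a local set that is minimal by inclusion among local sets. The order of $G$ is $|V|$. All graphs are finite, simple and undirected. *)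

theory Defs
  imports "Graph_Theory.Pair_Digraph"
begin

(* A finite simple undirected graph is a G with pair_graph G: finite, loop-free, and with a
   symmetric arc relation parcs G on pverts G, so that each edge {u,v} is the pair of arcs
   (u,v), (v,u) and multiple edges are excluded by construction. *)

definition neighborhood :: "'a pair_pre_digraph \<Rightarrow> 'a \<Rightarrow> 'a set" where
  "neighborhood G v = {w. (v, w) \<in> parcs G}"

definition odd_neighborhood :: "'a pair_pre_digraph \<Rightarrow> 'a set \<Rightarrow> 'a set" where
  "odd_neighborhood G D = {v \<in> pverts G. odd (card (neighborhood G v \<inter> D))}"

definition local_set :: "'a pair_pre_digraph \<Rightarrow> 'a set \<Rightarrow> bool" where
  "local_set G L \<longleftrightarrow> L \<noteq> {} \<and> (\<exists>D \<subseteq> pverts G. L = D \<union> odd_neighborhood G D)"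

definition minimal_local_set :: "'a pair_pre_digraph \<Rightarrow> 'a set \<Rightarrow> bool" where
  "minimal_local_set G A \<longleftrightarrow> local_set G A \<and> (\<forall>L. local_set G L \<and> L \<subseteq> A \<longrightarrow> L = A)"

definition minimal_local_set_bound :: "nat \<Rightarrow> nat" where
  "minimal_local_set_bound n = (if n mod 4 = 0 then n div 2 else n div 2 + 1)"

end

(* View D as a vector over GF(2).  If A is a minimal local set, every non-empty D with
   D \<union> Odd(D) \<subseteq> A satisfies D \<union> Odd(D) = A, so by linearity a set D \<subseteq> A is
   determined by the part of Odd(D) outside A together with the two bits recording whether a fixed
   v \<in> A lies in D and in Odd(D).  Hence 2^|A| \<le> 4 * 2^(n - |A|), that is 2|A| \<le> n + 2.
   In case of equality this encoding is onto, which yields two different generators of A whose sum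
   also generates A.  Each vertex of A then sees two distinct non-zero pairs of bits, so |A| has the
   parity of |D1 \<inter> Odd(D2)| + |D2 \<inter> Odd(D1)|, which is even since both terms count the
   arcs between D1 and D2.  This excludes |A| = n/2 + 1 for n divisible by 4. *)

theory Submission
  imports Defs
begin

section \<open>Parity and linear algebra over GF(2)\<close>

lemma odd_card_sym_diff:
  assumes "finite S" "finite T"
  shows "odd (card (sym_diff S T)) \<longleftrightarrow> odd (card S) \<noteq> odd (card T)"
proof -
  have "card S = card (S - T) + card (S \<inter> T)" "card T = card (T - S) + card (S \<inter> T)"
    using assms by (metis card_Diff_subset_Int card_mono Int_lower1 add.commute finite_Int
        le_add_diff_inverse Int_commute)+
  moreover have "card (sym_diff S T) = card (S - T) + card (T - S)"
    using assms by (intro card_Un_disjoint) auto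
  ultimately show ?thesis by presburger
qed

context pair_graph
begin

lemma finite_neighborhood: "finite (neighborhood G v)"
proof (rule finite_subset)
  show "neighborhood G v \<subseteq> pverts G"
    by (auto simp: neighborhood_def dest: in_arcsD2)
qed (rule pair_finite_verts)

text \<open>Symmetric difference is addition over GF(2), and \<open>odd_neighborhood G\<close> acts
  as the adjacency matrix, hence linearly.\<close>

lemma odd_neighborhood_sym_diff:
  "odd_neighborhood G (sym_diff D E) = sym_diff (odd_neighborhood G D) (odd_neighborhood G E)"
proof -
  have "odd (card (neighborhood G v \<inter> sym_diff D E)) \<longleftrightarrow>
      odd (card (neighborhood G v \<inter> D)) \<noteq> odd (card (neighborhood G v \<inter> E))" for v
  proof -
    have "neighborhood G v \<inter> sym_diff D E
        = sym_diff (neighborhood G v \<inter> D) (neighborhood G v \<inter> E)"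
      by auto
    then show ?thesis
      by (simp only: odd_card_sym_diff finite_neighborhood finite_Int simp_thms)
  qed
  then show ?thesis
    unfolding odd_neighborhood_def by blast
qed

text \<open>Grouping the arcs by their tail in \<open>D\<close> gives a sum of degrees into
  \<open>E\<close>, whose parity is that of the number of odd summands.\<close>

lemma odd_card_arcs_between:
  assumes "D \<subseteq> pverts G"
  shows "odd (card (parcs G \<inter> D \<times> E)) \<longleftrightarrow> odd (card (D \<inter> odd_neighborhood G E))"
proof -
  have fin: "finite D"
    using assms pair_finite_verts by (rule finite_subset)
  have "parcs G \<inter> D \<times> E = (SIGMA u:D. neighborhood G u \<inter> E)"
    by (auto simp: neighborhood_def)
  then have "card (parcs G \<inter> D \<times> E) = (\<Sum>u\<in>D. card (neighborhood G u \<inter> E))"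
    using fin by (simp add: finite_neighborhood)
  moreover have "{u \<in> D. odd (card (neighborhood G u \<inter> E))} = D \<inter> odd_neighborhood G E"
    using assms by (auto simp: odd_neighborhood_def)
  ultimately show ?thesis
    using fin by (simp add: even_sum_iff)
qed

text \<open>The bilinear form of the adjacency matrix is symmetric: reversing arcs is a bijection
  between both arc counts.\<close>

lemma odd_card_odd_neighborhood_commute:
  assumes "D \<subseteq> pverts G" "E \<subseteq> pverts G"
  shows "odd (card (D \<inter> odd_neighborhood G E)) \<longleftrightarrow> odd (card (E \<inter> odd_neighborhood G D))"
proof -
  have "parcs G \<inter> E \<times> D = (parcs G \<inter> D \<times> E)\<inverse>"
    using pair_sym_arcs by (auto simp: symmetric_def sym_def)
  then have "card (parcs G \<inter> E \<times> D) = card (parcs G \<inter> D \<times> E)"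
    by simp
  then show ?thesis
    using assms odd_card_arcs_between by metis
qed

section \<open>Upper bound\<close>

lemma minimal_local_set_card_le:
  assumes "minimal_local_set G A"
  shows "2 * card A \<le> card (pverts G) + 2"
    and "2 * card A = card (pverts G) + 2 \<Longrightarrow> even (card A)"
proof -
  let ?Odd = "odd_neighborhood G"
  have A: "A \<subseteq> pverts G" "A \<noteq> {}"
    using assms by (auto simp: minimal_local_set_def local_set_def odd_neighborhood_def)
  have covers: "D \<union> ?Odd D = A" if "D \<subseteq> A" "?Odd D \<subseteq> A" "D \<noteq> {}" for D
  proof -
    have "local_set G (D \<union> ?Odd D)"
      using that A unfolding local_set_def by blast
    then show ?thesis
      using assms that unfolding minimal_local_set_def by blast
  qed
  obtain v where v: "v \<in> A" using A by blast
  have finA: "finite A" using A pair_finite_verts finite_subset by blast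
  define enc where "enc D = (?Odd D - A, v \<in> D, v \<in> ?Odd D)" for D
  let ?T = "Pow (pverts G - A) \<times> (UNIV :: (bool \<times> bool) set)"
  have finT: "finite ?T" using pair_finite_verts by simp
  have inj: "inj_on enc (Pow A)"
  proof (rule inj_onI)
    fix D E assume DE: "D \<in> Pow A" "E \<in> Pow A" "enc D = enc E"
    let ?F = "sym_diff D E"
    \<comment> \<open>By linearity, equal codes cancel: nothing of the odd neighborhood of
      \<open>?F\<close> remains outside \<open>A\<close>, and both bits at \<open>v\<close> vanish.
      A non-empty \<open>?F\<close> would have to cover \<open>v\<close>.\<close>
    have "?Odd ?F \<subseteq> A" "v \<notin> ?F \<union> ?Odd ?F"
      using DE(3) v unfolding odd_neighborhood_sym_diff enc_def by blast+
    moreover have "?F \<subseteq> A" using DE by blast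
    ultimately have "?F = {}" using covers[of ?F] v by blast
    then show "D = E" by blast
  qed
  have img: "enc ` Pow A \<subseteq> ?T"
    by (auto simp: enc_def odd_neighborhood_def)
  have cardA: "card (enc ` Pow A) = 2 ^ card A"
    using card_image[OF inj] finA by (simp add: card_Pow)
  have bool: "card (UNIV :: (bool \<times> bool) set) = 2 ^ 2"
    by (simp add: card_cartesian_product flip: UNIV_Times_UNIV)
  have cardT: "card ?T = 2 ^ (card (pverts G) - card A + 2)"
    using A finA pair_finite_verts
    by (simp add: card_cartesian_product card_Pow bool card_Diff_subset power_add)
  \<comment> \<open>This keeps the truncated subtraction in the exponent of \<open>cardT\<close>
    exact.\<close>
  have leV: "card A \<le> card (pverts G)" using A pair_finite_verts card_mono by blast
  have "card A \<le> card (pverts G) - card A + 2"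
    using card_mono[OF finT img] unfolding cardA cardT
    by (rule power_le_imp_le_exp[rotated]) simp
  then show "2 * card A \<le> card (pverts G) + 2" using leV by linarith
  assume eq: "2 * card A = card (pverts G) + 2"
  then have "card A = card (pverts G) - card A + 2" using leV by linarith
  then have "card (enc ` Pow A) = card ?T" unfolding cardA cardT by presburger
  then have onto: "enc ` Pow A = ?T" using card_subset_eq[OF finT img] by blast
  \<comment> \<open>The empty first component keeps the odd neighborhoods inside \<open>A\<close>.
    The two bit pairs are non-zero and distinct, so \<open>D\<close>, \<open>E\<close> and their sum
    are all non-empty and generate \<open>A\<close>.\<close>
  have "({}, True, False) \<in> enc ` Pow A" "({}, False, True) \<in> enc ` Pow A"
    unfolding onto by auto
  then obtain D E where
      D: "D \<subseteq> A" "?Odd D \<subseteq> A" "v \<in> D" "v \<notin> ?Odd D" and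
      E: "E \<subseteq> A" "?Odd E \<subseteq> A" "v \<notin> E" "v \<in> ?Odd E"
    by (auto simp: enc_def)
  have "?Odd {} = {}" by (auto simp: odd_neighborhood_def)
  with E have "E \<noteq> {}" by auto
  have cD: "D \<union> ?Odd D = A" using D by (intro covers) auto
  have cE: "E \<union> ?Odd E = A" using E \<open>E \<noteq> {}\<close> by (intro covers)
  have "sym_diff D E \<subseteq> A" "?Odd (sym_diff D E) \<subseteq> A"
    using D(1,2) E(1,2) unfolding odd_neighborhood_sym_diff by fast+
  moreover have "sym_diff D E \<noteq> {}" using D(3) E(3) by fast
  ultimately have cDE: "sym_diff D E \<union> sym_diff (?Odd D) (?Odd E) = A"
    unfolding odd_neighborhood_sym_diff[symmetric] by (rule covers)
  \<comment> \<open>For u in \<open>A\<close> the membership pairs of u in (\<open>D\<close>,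
    \<open>?Odd D\<close>) and in (\<open>E\<close>, \<open>?Odd E\<close>) are distinct and
    non-zero, hence a basis of GF(2)^2. Their determinant, the right-hand side at u, is 1; outside
    \<open>A\<close> it is 0.\<close>
  have "A = sym_diff (D \<inter> ?Odd E) (E \<inter> ?Odd D)"
  proof (rule set_eqI)
    fix u
    have "u \<in> A \<longleftrightarrow> u \<in> D \<or> u \<in> ?Odd D"
      unfolding cD[symmetric] by (rule Un_iff)
    moreover have "u \<in> A \<longleftrightarrow> u \<in> E \<or> u \<in> ?Odd E"
      unfolding cE[symmetric] by (rule Un_iff)
    moreover have "u \<in> A \<longleftrightarrow> (u \<in> D) \<noteq> (u \<in> E) \<or> (u \<in> ?Odd D) \<noteq> (u \<in> ?Odd E)"
      unfolding cDE[symmetric] Un_iff Diff_iff by argo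
    ultimately show "u \<in> A \<longleftrightarrow> u \<in> sym_diff (D \<inter> ?Odd E) (E \<inter> ?Odd D)"
      unfolding Un_iff Diff_iff Int_iff by argo
  qed
  moreover have "finite D" "finite E" using D E finA finite_subset by blast+
  ultimately have "odd (card A) \<longleftrightarrow>
      odd (card (D \<inter> ?Odd E)) \<noteq> odd (card (E \<inter> ?Odd D))"
    using odd_card_sym_diff[of "D \<inter> ?Odd E" "E \<inter> ?Odd D"] by simp
  then show "even (card A)"
    using odd_card_odd_neighborhood_commute[of D E] D E A by blast
qed

lemma minimal_local_set_card_bound:
  assumes "minimal_local_set G A"
  shows "card A \<le> minimal_local_set_bound (card (pverts G))"
proof -
  note bnd = minimal_local_set_card_le[OF assms]
  show ?thesis
  proof (cases "card (pverts G) mod 4 = 0")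
    case True
    then obtain k where "card (pverts G) = 4 * k" by auto
    then show ?thesis
      \<comment> \<open>For order 4k, only the odd size 2k + 1 lies above the bound without
        violating the first inequality; the parity fact rules it out.\<close>
      using bnd by (cases "card A = 2 * k + 1") (auto simp: minimal_local_set_bound_def)
  next
    case False
    then show ?thesis using bnd(1) by (auto simp: minimal_local_set_bound_def)
  qed
qed

end

section \<open>Tightness\<close>

(* Vertex m + i is joined to 0 and i, so that a set D \<subseteq> {0..m} with no odd neighbor outside
   {0..m} is empty or {0..m}.  For n = 2m + 2 the extra vertex 2m + 1 is joined to all of
   {0..m} if m is even, which adds it to the local set, and is isolated otherwise. *)
definition extremal_edges :: "nat \<Rightarrow> nat \<Rightarrow> (nat \<times> nat) set" where
  "extremal_edges n m =
     {(0, m + i) | i. 1 \<le> i \<and> i \<le> m} \<union> {(i, m + i) | i. 1 \<le> i \<and> i \<le> m} \<union>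
     {(i, 2 * m + 1) | i. i \<le> m \<and> even n \<and> even m}"

definition extremal_graph :: "nat \<Rightarrow> nat pair_pre_digraph" where
  "extremal_graph n = (let R = extremal_edges n ((n - 1) div 2) in
     \<lparr>pverts = {..<n}, parcs = R \<union> R\<inverse>\<rparr>)"

definition extremal_local_set :: "nat \<Rightarrow> nat set" where
  "extremal_local_set n = (let m = (n - 1) div 2 in
     {0..m} \<union> (if even n \<and> even m then {2 * m + 1} else {}))"

lemma pair_graph_extremal_graph:
  assumes "n > 0"
  shows "pair_graph (extremal_graph n)"
proof -
  define m where "m = (n - 1) div 2"
  define R where "R = extremal_edges n m"
  have G: "extremal_graph n = \<lparr>pverts = {..<n}, parcs = R \<union> R\<inverse>\<rparr>"
    by (simp add: extremal_graph_def R_def m_def Let_def)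
  have n: "2 * m + 1 \<le> n" "even n \<longrightarrow> n = 2 * m + 2"
    using assms by (auto simp: m_def)
  have R: "R \<subseteq> {..<n} \<times> {..<n}" using n by (auto simp: R_def extremal_edges_def)
  then have "finite R" using finite_subset by blast
  have irr: "(u, u) \<notin> R" for u
    by (auto simp: R_def extremal_edges_def)
  show ?thesis unfolding G
    using R irr \<open>finite R\<close>
    by unfold_locales (auto simp: symmetric_def sym_def with_proj_def arcs_ends_def arc_to_ends_def)
qed

text \<open>With n = 2m + 2, divisibility of n by 4 means that m is odd, which is exactly when the
  extra vertex is left out.\<close>

lemma card_extremal_local_set:
  assumes "n > 0"
  shows "card (extremal_local_set n) = minimal_local_set_bound n"
proof -
  define m where "m = (n - 1) div 2"
  have "card (extremal_local_set n) = m + 1 + (if even n \<and> even m then 1 else 0)"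
    by (auto simp: extremal_local_set_def Let_def m_def)
  moreover have "n = 2 * m + 1 \<or> n = 2 * m + 2"
    using assms unfolding m_def by presburger
  ultimately show ?thesis
    unfolding minimal_local_set_bound_def by (elim disjE) (simp_all, presburger+)
qed

lemma minimal_local_set_extremal:
  assumes "n > 0"
  shows "minimal_local_set (extremal_graph n) (extremal_local_set n)"
proof -
  define m where "m = (n - 1) div 2"
  define apex where "apex \<longleftrightarrow> even n \<and> even m"
  define G where "G = extremal_graph n"
  define A where "A = extremal_local_set n"
  let ?Odd = "odd_neighborhood G"
  have n: "2 * m + 1 \<le> n" "n \<le> 2 * m + 2" "apex \<Longrightarrow> n = 2 * m + 2"
    using assms by (auto simp: m_def apex_def)
  have V: "pverts G = {..<n}"
    by (simp add: G_def extremal_graph_def Let_def)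
  have A: "A = {0..m} \<union> (if apex then {2 * m + 1} else {})"
    by (simp add: A_def extremal_local_set_def Let_def apex_def m_def)
  have arcs: "parcs G = extremal_edges n m \<union> (extremal_edges n m)\<inverse>"
    by (simp add: G_def extremal_graph_def m_def Let_def)
  have N_outer: "neighborhood G (m + i) = {0, i}" if "1 \<le> i" "i \<le> m" for i
    using that by (auto simp: neighborhood_def arcs extremal_edges_def)
  have N_last: "neighborhood G (2 * m + 1) = (if apex then {0..m} else {})"
    by (auto simp: neighborhood_def arcs extremal_edges_def apex_def)
  have N_apex: "2 * m + 1 \<in> neighborhood G u" if "u \<le> m" apex for u
    using that by (auto simp: neighborhood_def arcs extremal_edges_def apex_def)
  have outer: "m + i \<notin> A" "m + i < n" if "1 \<le> i" "i \<le> m" for i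
    using that n by (auto simp: A)
  \<comment> \<open>The extra vertex sees m + 1 elements, an odd number because m is even.\<close>
  have last_odd: "2 * m + 1 \<in> ?Odd D" if "{0..m} \<subseteq> D" apex for D
  proof -
    have "neighborhood G (2 * m + 1) \<inter> D = {0..m}" using that N_last by auto
    then show ?thesis using that n by (simp add: odd_neighborhood_def V apex_def)
  qed
  have generator: "?Odd {0..m} \<subseteq> A"
  proof
    fix u assume u: "u \<in> ?Odd {0..m}"
    consider "u \<le> m" | i where "u = m + i" "1 \<le> i" "i \<le> m" | "u = 2 * m + 1"
    proof -
      have "u < n" using u by (simp add: odd_neighborhood_def V)
      then have "u \<le> m \<or> (u = m + (u - m) \<and> 1 \<le> u - m \<and> u - m \<le> m) \<or> u = 2 * m + 1"
        using n by linarith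
      then show ?thesis using that by blast
    qed
    then show "u \<in> A"
    proof cases
      case (2 i)
      \<comment> \<open>An outer vertex sees exactly two elements of {0..m}, so it is not an odd
        neighbor.\<close>
      have "{0, i} \<inter> {0..m} = {0, i}" using 2 by auto
      then show ?thesis using u 2 by (simp add: odd_neighborhood_def N_outer)
    next
      case 3
      then have "neighborhood G (2 * m + 1) \<inter> {0..m} \<noteq> {}"
        using u by (auto simp: odd_neighborhood_def)
      then have apex using N_last by (auto split: if_splits)
      then show ?thesis using 3 by (simp add: A)
    qed (simp add: A)
  qed
  \<comment> \<open>This serves twice: for {0..m} it shows that \<open>A\<close> is a local set, and
    for arbitrary generators it shows minimality.\<close>
  have covers: "A \<subseteq> D \<union> ?Odd D" if D: "D \<subseteq> A" "?Odd D \<subseteq> A" "D \<noteq> {}" for D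
  proof -
    have iff: "0 \<in> D \<longleftrightarrow> i \<in> D" if i: "1 \<le> i" "i \<le> m" for i
    proof -
      \<comment> \<open>The only neighbors of m + i are 0 and i, so even parity forces both or
        neither into \<open>D\<close>.\<close>
      have "m + i \<notin> ?Odd D" using outer(1)[OF i] D by blast
      then have "even (card ({0, i} \<inter> D))"
        using outer(2)[OF i] by (simp add: odd_neighborhood_def V N_outer[OF i])
      then show ?thesis using i by (auto simp: Int_insert_left split: if_splits)
    qed
    show ?thesis
    proof (cases "0 \<in> D")
      case True
      have "{0..m} \<subseteq> D"
      proof
        fix i assume "i \<in> {0..m}"
        then show "i \<in> D" using iff[of i] True by (cases "i = 0") auto
      qed
      then show ?thesis using last_odd unfolding A by auto
    next
      case False
      have "i \<notin> D" if "i \<le> m" for i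
        using iff[of i] False that by (cases "i = 0") auto
      \<comment> \<open>Only the extra vertex is left as a generator; it is adjacent to all of
        {0..m}, so it still yields all of \<open>A\<close>.\<close>
      then have "D = {2 * m + 1}" "apex"
        using D unfolding A by (auto split: if_splits)
      then show ?thesis
        using N_apex n by (auto simp: A odd_neighborhood_def V)
    qed
  qed
  have AV: "A \<subseteq> pverts G"
    unfolding A V using n by auto
  have "local_set G A"
    unfolding local_set_def
  proof (intro conjI exI)
    show "A \<noteq> {}" by (auto simp: A)
    show "{0..m} \<subseteq> pverts G" using AV by (auto simp: A)
    show "A = {0..m} \<union> ?Odd {0..m}"
      using covers[of "{0..m}"] generator by (auto simp: A)
  qed
  moreover have "L = A" if L: "local_set G L" "L \<subseteq> A" for L
  proof -
    obtain D where D: "L = D \<union> ?Odd D" "L \<noteq> {}"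
      using L(1) unfolding local_set_def by blast
    then have "D \<noteq> {}" by (auto simp: odd_neighborhood_def)
    moreover have "D \<subseteq> A" "?Odd D \<subseteq> A" using L(2) D(1) by simp_all
    ultimately have "A \<subseteq> L" using covers[of D] D(1) by simp
    with L(2) show ?thesis by (rule subset_antisym)
  qed
  ultimately show ?thesis
    unfolding minimal_local_set_def G_def A_def by blast
qed

theorem proposition6:
  shows "(\<forall>(G :: 'a pair_pre_digraph) n A.
            pair_graph G \<and> card (pverts G) = n \<and> minimal_local_set G A
              \<longrightarrow> card A \<le> minimal_local_set_bound n) \<and>
         (\<forall>n>0. \<exists>(G :: nat pair_pre_digraph) A.
            pair_graph G \<and> card (pverts G) = n \<and> minimal_local_set G A \<and>
            card A = minimal_local_set_bound n)"
proof (intro conjI allI impI)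
  fix G :: "'a pair_pre_digraph" and n A
  assume "pair_graph G \<and> card (pverts G) = n \<and> minimal_local_set G A"
  then show "card A \<le> minimal_local_set_bound n"
    using pair_graph.minimal_local_set_card_bound by blast
next
  fix n :: nat assume "n > 0"
  moreover have "card (pverts (extremal_graph n)) = n"
    by (simp add: extremal_graph_def Let_def)
  ultimately show "\<exists>(G :: nat pair_pre_digraph) A. pair_graph G \<and> card (pverts G) = n \<and>
      minimal_local_set G A \<and> card A = minimal_local_set_bound n"
    using pair_graph_extremal_graph minimal_local_set_extremal card_extremal_local_set by blast
qed

end
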